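(* For each integer $k \geq 2$ there exists a cubic hamiltonian-connected graph on $6k$ vertices with cycle spectrum $\{4\} \cup \{3m+2: m \in [k-1]\} \cup [3k,6k]$.
   Context: All graphs are finite and simple. A graph is hamiltonian-connected if between every two distinct vertices there is a path visiting every vertex of the graph. The cycle spectrum of a graph $G$ is the set of integers $\ell$ such that $G$ contains a cycle of length $\ell$. For integers $a\le b$, $[a,b]=\{j\in\mathbb{Z}: a\le j\le b\}$, and $[n]=\{1,\ldots,n\}$. *)

theory Defs
  imports "Graph_Theory.Graph_Theory"
begin

text \<open>
  Finite simple graphs are the finite, loop-free, symmetric digraphs without parallel arcs
  (locale \<^locale>\<open>graph\<close>, or \<^locale>\<open>pair_graph\<close> when the arcs are ordered pairs): an edge
  \<open>uv\<close> is the pair of opposite arcs \<open>(u, v)\<close>, \<open>(v, u)\<close>. The degree of a vertex is therefore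
  its out-degree (which is also its in-degree), not the sum of the two.
\<close>

definition cubic :: "('a, 'b) pre_digraph \<Rightarrow> bool" where
  "cubic G \<longleftrightarrow> (\<forall>v \<in> verts G. out_degree G v = 3)"

definition hamiltonian_connected :: "('a, 'b) pre_digraph \<Rightarrow> bool" where
  "hamiltonian_connected G \<longleftrightarrow>
     (\<forall>u \<in> verts G. \<forall>v \<in> verts G. u \<noteq> v \<longrightarrow>
       (\<exists>p. pre_digraph.apath G u p v \<and> set (pre_digraph.awalk_verts G u p) = verts G))"

text \<open>
  In a symmetric digraph, traversing an edge back and forth is a directed cycle of length 2.
  The bound \<open>3 \<le> length p\<close> removes exactly these; the directed cycles of length at least 3 are
  the (oriented) cycles of the underlying simple graph.
\<close>

definition cycle_spectrum :: "('a, 'b) pre_digraph \<Rightarrow> nat set" where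
  "cycle_spectrum G = {length p | p. pre_digraph.cycle G p \<and> 3 \<le> length p}"

end

theory Submission
  imports Defs
begin

text \<open>
  Consider the infinite strip with two rows and columns indexed by the integers. Column \<open>c\<close> contains
  a rung iff \<open>c mod 3 = 1\<close>; consecutive columns \<open>c, c + 1\<close> are joined by the two horizontal edges,
  and completely if \<open>c mod 3 = 2\<close>. The graph is the quotient of the strip by the translation by \<open>3k\<close>
  columns.

  A cycle that misses a column lifts to the strip. There it meets all columns between its extreme
  columns twice, and the residues of the extreme columns modulo 3 determine whether they are met
  once or twice; so its length is 4 or congruent to 2 modulo 3. A cycle that meets every column has length at
  least \<open>3k\<close>. Conversely, a path running once around the ring can use 3 to 6 vertices in each
  period. For Hamiltonian paths, the automorphisms reduce the pairs of end points to a few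
  types, each with an explicit path which traverses one part of the ring once and the other part
  twice.
\<close>

section \<open>The strip and its cycles\<close>

fun strip_adj :: "int \<times> bool \<Rightarrow> int \<times> bool \<Rightarrow> bool" where
  "strip_adj (c, s) (d, t) \<longleftrightarrow>
     c = d \<and> s \<noteq> t \<and> c mod 3 = 1 \<or>
     d = c + 1 \<and> (s = t \<or> c mod 3 = 2) \<or>
     c = d + 1 \<and> (s = t \<or> d mod 3 = 2)"

declare split_paired_Ex [simp del] split_paired_All [simp del]

section \<open>Symmetries and neighbourhoods of the strip\<close>

lemma strip_adj_sym: "strip_adj p q \<longleftrightarrow> strip_adj q p"
  by (cases p; cases q) auto

lemma strip_adj_irrefl: "\<not> strip_adj p p"
  by (cases p) auto

lemma strip_adj_fst: "strip_adj p q \<Longrightarrow> \<bar>fst p - fst q\<bar> \<le> 1"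
  by (cases p; cases q) auto

lemma strip_adj_shift:
  assumes "3 dvd a"
  shows "strip_adj (c + a, s) (d + a, t) \<longleftrightarrow> strip_adj (c, s) (d, t)"
  using assms by (auto elim!: dvdE)

text \<open>The reflection fixes the rung column 1 and sends the completely joined columns 2, 3 to
  the columns 0, -1, again completely joined. It exchanges the residues 0 and 2.\<close>

lemma strip_adj_reflect:
  "strip_adj (2 - c, s) (2 - d, t) \<longleftrightarrow> strip_adj (c, s) (d, t)"
proof -
  have rung: "(2 - c) mod 3 = 1 \<longleftrightarrow> c mod 3 = 1" for c :: int
    by presburger
  have cut: "(2 - (c + 1)) mod 3 = 2 \<longleftrightarrow> c mod 3 = 2" for c :: int
    by presburger
  have step: "strip_adj (2 - c, s) (2 - (c + 1), t) \<longleftrightarrow> strip_adj (c, s) (c + 1, t)" for c s t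
    unfolding strip_adj.simps cut by auto
  consider "d = c" | "d = c + 1" | "c = d + 1" | "d \<noteq> c" "d \<noteq> c + 1" "c \<noteq> d + 1" by blast
  then show ?thesis
  proof cases
    case 1
    then show ?thesis unfolding strip_adj.simps using rung by simp
  next
    case 2
    then show ?thesis using step by simp
  next
    case 3
    then show ?thesis using step[of d t s] strip_adj_sym by blast
  qed (simp add: strip_adj.simps)
qed

text \<open>\<open>e\<close> selects the blocks of three columns whose rows are exchanged. Both ends
  of an edge inside a block are exchanged together; between blocks the join is complete, so rows do
  not matter there.\<close>

lemma strip_adj_twist:
  "strip_adj (c, s \<noteq> e (c div 3)) (d, t \<noteq> e (d div 3)) \<longleftrightarrow> strip_adj (c, s) (d, t)"
proof -
  have same: "(c + 1) div 3 = c div 3" if "c mod 3 \<noteq> 2" for c :: int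
    using that by presburger
  have step: "strip_adj (c, s \<noteq> e (c div 3)) (c + 1, t \<noteq> e ((c + 1) div 3)) \<longleftrightarrow> strip_adj (c, s) (c + 1, t)"
    for c s t using same[of c] by (cases "c mod 3 = 2") auto
  consider "d = c" | "d = c + 1" | "c = d + 1" | "d \<noteq> c" "d \<noteq> c + 1" "c \<noteq> d + 1" by blast
  then show ?thesis
  proof cases
    case 1
    then show ?thesis by auto
  next
    case 2
    then show ?thesis using step by simp
  next
    case 3
    then show ?thesis using step[of d t s] by (simp only: strip_adj_sym[of "(d + 1, _)"])
  next
    case 4
    then show ?thesis by simp
  qed
qed

declare strip_adj.simps [simp del]

lemma strip_neighbours:
  "{q. strip_adj (c, s) q} =
     (if c mod 3 = 0 then {(c + 1, s), (c - 1, s), (c - 1, \<not> s)}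
      else if c mod 3 = 1 then {(c + 1, s), (c - 1, s), (c, \<not> s)}
      else {(c + 1, s), (c - 1, s), (c + 1, \<not> s)})" (is "?A = ?B")
proof (rule set_eqI)
  fix q :: "int \<times> bool"
  obtain d t where q: "q = (d, t)" by (cases q)
  have m: "c mod 3 = 2" if "c mod 3 \<noteq> 0" "c mod 3 \<noteq> 1" using that by presburger
  have m': "(c - 1) mod 3 = 2 \<longleftrightarrow> c mod 3 = 0" by presburger
  consider "d = c" | "d = c + 1" | "d = c - 1" | "d \<noteq> c" "d \<noteq> c + 1" "d \<noteq> c - 1" by blast
  then show "q \<in> ?A \<longleftrightarrow> q \<in> ?B"
  proof cases
    case 4
    then have "\<not> strip_adj (c, s) (d, t)" by (simp add: strip_adj.simps)
    with 4 q show ?thesis by simp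
  qed (use m m' in \<open>auto simp: q strip_adj.simps\<close>)
qed

lemma card_strip_neighbours: "card {q. strip_adj p q} = 3"
  by (cases p) (auto simp: strip_neighbours)

section \<open>Extreme columns and lengths of cycles in the strip\<close>

text \<open>By \<open>eq_iff\<close>, \<open>f\<close> is periodic and injective on a period: a
  cycle unrolled over the naturals. A vertex in the leftmost column has two cycle neighbours, none
  further left. Residue 0 offers only one candidate; residue 1 offers two, one across the rung, so
  the column is full; for residue 2, two cycle vertices in the column share both neighbours and
  close a 4-cycle.\<close>

lemma strip_cycle_min_end:
  fixes f :: "nat \<Rightarrow> int \<times> bool"
  assumes n: "3 \<le> n"
    and eq_iff: "\<And>i j. f i = f j \<longleftrightarrow> int n dvd int i - int j"
    and adj: "\<And>i. strip_adj (f i) (f (Suc i))"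
    and i: "fst (f i) = c"
    and min: "\<And>j. c \<le> fst (f j)"
  shows "n = 4 \<or> c mod 3 = 1 \<and> card {s. (c, s) \<in> range f} = 2
     \<or> c mod 3 = 2 \<and> card {s. (c, s) \<in> range f} = 1"
proof -
  \<comment> \<open>\<open>f (j + n - 1)\<close> is the predecessor of \<open>f j\<close>, moved on
    by a period because \<open>j\<close> may be 0.\<close>
  have nb: "f (Suc j) \<noteq> f (j + n - 1)" "{f (Suc j), f (j + n - 1)} \<subseteq> {q. strip_adj (c, s) q \<and> c \<le> fst q}"
    if "f j = (c, s)" for j s
  proof -
    have "\<not> int n dvd int (j + n - 1) - int (Suc j)"
    proof
      assume "int n dvd int (j + n - 1) - int (Suc j)"
      then have "int n dvd int n - 2" using n by (simp add: of_nat_diff)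
      then have "int n dvd 2" by (metis dvd_diff_commute dvd_refl dvd_diff_right_iff)
      then show False using n zdvd_imp_le by fastforce
    qed
    then show "f (Suc j) \<noteq> f (j + n - 1)" using eq_iff by metis
    have "f (Suc (j + n - 1)) = f j" using n by (subst eq_iff) simp
    then have "strip_adj (f (j + n - 1)) (c, s)" using adj[of "j + n - 1"] that by simp
    then show "{f (Suc j), f (j + n - 1)} \<subseteq> {q. strip_adj (c, s) q \<and> c \<le> fst q}"
      using adj[of j] min that by (auto simp: strip_adj_sym)
  qed
  obtain s where s: "f i = (c, s)" using i by (cases "f i") auto
  have all: "{q. strip_adj (c, s) q \<and> c \<le> fst q} =
     (if c mod 3 = 0 then {(c + 1, s)} else if c mod 3 = 1 then {(c + 1, s), (c, \<not> s)}
      else {(c + 1, s), (c + 1, \<not> s)})" for s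
    unfolding Collect_conj_eq strip_neighbours by auto
  have "c mod 3 = 0 \<or> c mod 3 = 1 \<or> c mod 3 = 2" by presburger
  then consider "c mod 3 = 0" | "c mod 3 = 1" | "c mod 3 = 2" by blast
  then show ?thesis
  proof cases
    case 1
    then show ?thesis using nb[OF s] all[of s] by auto
  next
    case 2
    then have "{f (Suc i), f (i + n - 1)} \<subseteq> {(c + 1, s), (c, \<not> s)}"
      using nb(2)[OF s, unfolded all] by simp
    then have "(c, \<not> s) = f (Suc i) \<or> (c, \<not> s) = f (i + n - 1)"
      using nb(1)[OF s] by (metis insert_subset insert_iff empty_iff)
    then have "(c, \<not> s) \<in> range f" by (elim disjE) (simp_all only: rangeI)
    moreover have "(c, s) \<in> range f" using s by (metis rangeI)
    ultimately have "(c, t) \<in> range f" for t by (cases t; cases s) simp_all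
    then have "{s. (c, s) \<in> range f} = UNIV" by simp
    with 2 show ?thesis by simp
  next
    case 3
    show ?thesis
    proof (cases "(c, \<not> s) \<in> range f")
      case False
      moreover have "(c, s) \<in> range f" using s by (metis rangeI)
      ultimately have "(c, t) \<in> range f \<longleftrightarrow> t = s" for t by (cases t; cases s) simp_all
      then have "{s. (c, s) \<in> range f} = {s}" by simp
      with 3 show ?thesis by simp
    next
      case True
      then obtain j where j: "f j = (c, \<not> s)" by auto
      have ne: "f i \<noteq> f j" using s j by simp
      have "{f (Suc i), f (i + n - 1)} \<subseteq> {(c + 1, s), (c + 1, \<not> s)}"
           "{f (Suc j), f (j + n - 1)} \<subseteq> {(c + 1, s), (c + 1, \<not> s)}"
        using nb(2)[OF s, unfolded all] nb(2)[OF j, unfolded all] 3 by (simp_all add: insert_commute)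
      moreover have "f (Suc i) \<noteq> f (Suc j)" using ne by (simp add: eq_iff)
      moreover have "x = y' \<and> x' = y"
        if "{x, y} \<subseteq> {u, v}" "{x', y'} \<subseteq> {u, v}" "x \<noteq> x'" "x \<noteq> y" "x' \<noteq> y'"
        for x y x' y' u v :: "int \<times> bool"
        using that by blast
      ultimately have "f (Suc i) = f (j + n - 1)" "f (Suc j) = f (i + n - 1)"
        using nb(1)[OF s] nb(1)[OF j] by metis+
      \<comment> \<open>Each of the two vertices lies two steps after the other modulo
        \<open>n\<close>, so \<open>n\<close> divides 2 + 2.\<close>
      then have "int n dvd int (Suc i) - int (j + n - 1)" "int n dvd int (Suc j) - int (i + n - 1)"
        by (simp_all add: eq_iff)
      then have "int n dvd (int (Suc i) - int (j + n - 1)) + (int (Suc j) - int (i + n - 1)) + 2 * int n"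
        by (intro dvd_add) auto
      also have "\<dots> = 4" using n by (simp add: of_nat_diff)
      finally have "n dvd 4" by (metis of_nat_dvd_iff of_nat_numeral)
      moreover from this have "n \<le> 4" by (rule dvd_imp_le) simp
      moreover have "\<not> 3 dvd (4::nat)" by simp
      ultimately have "n = 4" using n by (cases "n = 3") auto
      then show ?thesis ..
    qed
  qed
qed

lemma inj_on_period:
  fixes f :: "nat \<Rightarrow> 'a"
  assumes eq_iff: "\<And>i j. f i = f j \<longleftrightarrow> int n dvd int i - int j"
  shows "inj_on f {..<n}"
proof (rule inj_onI)
  fix i j assume "i \<in> {..<n}" "j \<in> {..<n}" "f i = f j"
  then have "int n dvd int i - int j" "\<bar>int i - int j\<bar> < int n" by (auto simp: eq_iff)
  then have "int i - int j = 0" using zdvd_not_zless[of "\<bar>int i - int j\<bar>" "int n"] by auto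
  then show "i = j" by simp
qed

text \<open>Apart from the case \<open>n = 4\<close>, the end lemma restricts the extreme columns
  \<open>L\<close> and \<open>M\<close>, and all columns strictly between are full. So
  \<open>n\<close> is \<open>card A + card B + 2 * (M - L - 1)\<close>, which is 2 modulo 3 in each
  of the four combinations of ends.\<close>

lemma strip_cycle_length:
  fixes f :: "nat \<Rightarrow> int \<times> bool"
  assumes n: "3 \<le> n"
    and eq_iff: "\<And>i j. f i = f j \<longleftrightarrow> int n dvd int i - int j"
    and adj: "\<And>i. strip_adj (f i) (f (Suc i))"
  shows "n = 4 \<or> n mod 3 = 2"
proof (cases "n = 4")
  case False
  let ?V = "range f"
  have per: "f (i + n) = f i" for i by (subst eq_iff) simp
  have V: "?V = f ` {..<n}"
  proof -
    have "f i = f (i mod n)" for i by (subst eq_iff) (simp add: zmod_int minus_mod_eq_mult_div)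
    then show ?thesis using n by (auto simp: image_iff) (metis mod_less_divisor not_numeral_le_zero gr0I lessThan_iff)
  qed
  have "inj_on f {..<n}" by (rule inj_on_period[OF eq_iff])
  then have card_V: "card ?V = n" unfolding V by (simp add: card_image)
  have fin: "finite ?V" "finite (fst ` ?V)" unfolding V by simp_all
  define L where "L = Min (fst ` ?V)"
  define M where "M = Max (fst ` ?V)"
  have "L \<in> fst ` ?V" "M \<in> fst ` ?V" unfolding L_def M_def by (rule Min_in Max_in; use fin in simp)+
  then obtain i j0 where i_less: "i < n" "j0 < n" and i: "fst (f i) = L" and j0: "fst (f j0) = M"
    unfolding V by auto
  have bounds: "L \<le> fst (f j)" "fst (f j) \<le> M" for j
    unfolding L_def M_def using fin by simp_all
  have lower: "L mod 3 = 1 \<and> card {s. (L, s) \<in> ?V} = 2 \<or> L mod 3 = 2 \<and> card {s. (L, s) \<in> ?V} = 1"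
    using strip_cycle_min_end[OF n eq_iff adj i] bounds False by blast
  \<comment> \<open>The mirror image turns the rightmost column into a leftmost one, so the same
    lemma describes both ends.\<close>
  define g where "g j = (2 - fst (f j), snd (f j))" for j
  have "g i = g j \<longleftrightarrow> int n dvd int i - int j" for i j
    unfolding g_def eq_iff[symmetric] by (simp add: prod_eq_iff)
  moreover have "strip_adj (g j) (g (Suc j))" for j
    unfolding g_def strip_adj_reflect using adj[of j] by simp
  moreover have "fst (g j0) = 2 - M" "2 - M \<le> fst (g j)" for j
    using j0 bounds unfolding g_def by simp_all
  ultimately have "(2 - M) mod 3 = 1 \<and> card {s. (2 - M, s) \<in> range g} = 2
      \<or> (2 - M) mod 3 = 2 \<and> card {s. (2 - M, s) \<in> range g} = 1"
    using strip_cycle_min_end[OF n, of g j0 "2 - M"] False by blast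
  moreover have "(2 - M, s) \<in> range g \<longleftrightarrow> (M, s) \<in> ?V" for s
    unfolding g_def image_iff by (auto simp: prod_eq_iff)
  moreover have "(2 - M) mod 3 = 1 \<longleftrightarrow> M mod 3 = 1" "(2 - M) mod 3 = 2 \<longleftrightarrow> M mod 3 = 0"
    by presburger+
  ultimately have upper:
    "M mod 3 = 1 \<and> card {s. (M, s) \<in> ?V} = 2 \<or> M mod 3 = 0 \<and> card {s. (M, s) \<in> ?V} = 1"
    by simp
  have "L \<noteq> M"
  proof
    assume "L = M"
    then have "fst (f j) = L" for j using bounds[of j] by simp
    then have "?V \<subseteq> {L} \<times> UNIV" by (simp add: image_subset_iff mem_Times_iff)
    from card_mono[OF _ this] card_V n show False by (simp add: card_cartesian_product)
  qed
  with bounds[of i] i have "L < M" by simp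
  text \<open>The cycle consists of two arcs between its extreme columns, and each visits every column
    in between.\<close>
  have full: "(c, s) \<in> ?V" if c: "L < c" "c < M" for c s
  proof -
    have step: "\<bar>fst (f (Suc j)) - fst (f j)\<bar> \<le> 1" for j
      using strip_adj_fst[OF adj[of j]] by linarith
    \<comment> \<open>\<open>j\<close> is a time in the period from \<open>i\<close> at which the
      cycle is in column \<open>M\<close>. The column changes by at most 1 per step, so
      \<open>c\<close> is met both on the way from \<open>i\<close> to \<open>j\<close> and on the
      way from \<open>j\<close> to \<open>i + n\<close>. The two times are less than a period apart,
      hence give different vertices of the column.\<close>
    define j where "j = (if i \<le> j0 then j0 else j0 + n)"
    have ji: "i \<le> j" "j < i + n" and "f j = f j0"
      using per i_less unfolding j_def by auto
    then have j: "fst (f j) = M" using j0 by simp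
    have "\<exists>a. i \<le> a \<and> a \<le> j \<and> fst (f a) = c"
      by (rule nat_intermed_int_val) (use step ji i j c in simp_all)
    then obtain a where a: "i \<le> a" "a \<le> j" "fst (f a) = c" by blast
    have "\<exists>b. j \<le> b \<and> b \<le> i + n \<and> - fst (f b) = - c"
    proof (rule nat_intermed_int_val)
      have "\<bar>- fst (f (Suc x)) - - fst (f x)\<bar> \<le> 1" for x using step[of x] by simp
      then show "\<forall>x. j \<le> x \<and> x < i + n \<longrightarrow> \<bar>- fst (f (Suc x)) - - fst (f x)\<bar> \<le> 1" by blast
    qed (use ji i j c per[of i] in simp_all)
    then obtain b where b: "j \<le> b" "b \<le> i + n" "fst (f b) = c" by auto
    have "a \<noteq> j" "a \<noteq> i" using a(3) i j c by (metis less_irrefl)+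
    with a(1,2) b(1,2) have "a < b" "b < a + n" by linarith+
    then have "0 < int b - int a" "int b - int a < int n" by linarith+
    then have "\<not> int n dvd int b - int a" by (rule zdvd_not_zless)
    then have "f b \<noteq> f a" unfolding eq_iff .
    then have "snd (f b) \<noteq> snd (f a)" unfolding prod_eq_iff a(3) b(3) by simp
    then have "s = snd (f a) \<or> s = snd (f b)" by blast
    then have "(c, s) = f a \<or> (c, s) = f b" unfolding prod_eq_iff a(3) b(3) by simp
    then show ?thesis by (metis rangeI)
  qed
  define A where "A = {s. (L, s) \<in> ?V}"
  define B where "B = {s. (M, s) \<in> ?V}"
  have split: "?V = {L} \<times> A \<union> ({M} \<times> B \<union> {L<..<M} \<times> UNIV)"
  proof (intro equalityI subsetI)
    fix p assume "p \<in> ?V"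
    moreover obtain d t where p: "p = (d, t)" by (cases p)
    ultimately have "(d, t) \<in> ?V" "L \<le> d" "d \<le> M" using bounds by (metis fst_conv imageE)+
    then have "d = L \<and> t \<in> A \<or> d = M \<and> t \<in> B \<or> L < d \<and> d < M"
      unfolding A_def B_def mem_Collect_eq by (metis le_less)
    then show "p \<in> {L} \<times> A \<union> ({M} \<times> B \<union> {L<..<M} \<times> UNIV)"
      unfolding p by simp
  next
    fix p assume "p \<in> {L} \<times> A \<union> ({M} \<times> B \<union> {L<..<M} \<times> UNIV)"
    then show "p \<in> ?V"
      using full unfolding A_def B_def by (elim UnE SigmaE) simp_all
  qed
  have "card ({L} \<times> A \<union> ({M} \<times> B \<union> {L<..<M} \<times> UNIV))
      = card ({L} \<times> A) + card ({M} \<times> B \<union> {L<..<M} \<times> UNIV)"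
    using \<open>L < M\<close> by (intro card_Un_disjoint) auto
  also have "card ({M} \<times> B \<union> {L<..<M} \<times> UNIV) = card ({M} \<times> B) + card ({L<..<M} \<times> (UNIV :: bool set))"
    by (intro card_Un_disjoint) auto
  finally have "n = card A + (card B + 2 * nat (M - L - 1))"
    unfolding split[symmetric] card_V by (simp add: card_cartesian_product)
  then have "int n = int (card A) + int (card B) + 2 * (M - L - 1)"
    using \<open>L < M\<close> by simp
  with lower upper show ?thesis
    unfolding A_def[symmetric] B_def[symmetric] by (elim disjE conjE) (simp, presburger)+
qed simp

section \<open>Cycles and walks as sequences of vertices\<close>

lemma pawalk_verts_conv: "pcas u p v \<Longrightarrow> pawalk_verts u p = u # map snd p"
  by (induction p arbitrary: u) auto

lemma pcas_nth: "pcas u p v \<Longrightarrow> i < length p \<Longrightarrow> fst (p ! i) = (if i = 0 then u else snd (p ! (i - 1)))"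
proof (induction p arbitrary: u i)
  case (Cons e p)
  then show ?case by (cases i) auto
qed simp

lemma pcas_last: "pcas u p v \<Longrightarrow> p \<noteq> [] \<Longrightarrow> snd (last p) = v"
  by (induction p arbitrary: u) (auto split: if_splits)

text \<open>\<open>f i\<close> is the head of arc \<open>i\<close> modulo the length; distinctness
  of the heads gives the equivalence. This is the form of a cycle used in the length
  arguments.\<close>

lemma cycleE:
  assumes "pre_digraph.cycle (with_proj G) p"
  obtains f :: "nat \<Rightarrow> 'a"
  where "\<And>i j. f i = f j \<longleftrightarrow> int (length p) dvd int i - int j"
    and "\<And>i. (f i, f (Suc i)) \<in> parcs G"
proof -
  let ?n = "length p"
  obtain u where p: "set p \<subseteq> parcs G" "pcas u p u" "distinct (map snd p)" "p \<noteq> []"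
    using assms unfolding pre_digraph.cycle_def pre_digraph.awalk_def
      awalk_verts_with_proj_eq cas_with_proj_eq by (auto simp: pawalk_verts_conv)
  define f where "f i = snd (p ! (i mod ?n))" for i
  have less: "i mod ?n < ?n" for i using p(4) by simp
  have "f i = f j \<longleftrightarrow> i mod ?n = j mod ?n" for i j
    using nth_eq_iff_index_eq[OF p(3), of "i mod ?n" "j mod ?n"] less unfolding f_def by simp
  then have "f i = f j \<longleftrightarrow> int ?n dvd int i - int j" for i j
    by (simp add: mod_eq_dvd_iff[symmetric] zmod_int[symmetric])
  moreover have "(f i, f (Suc i)) \<in> parcs G" for i
  proof -
    have "fst (p ! (Suc i mod ?n)) = f i"
    proof (cases "Suc i mod ?n = 0")
      case True
      \<comment> \<open>At the wrap-around, arc 0 starts at the base point \<open>u\<close>, which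
        is the head of the last arc.\<close>
      then have "i mod ?n = ?n - 1" by (simp add: mod_Suc split: if_splits)
      then have "f i = u" using pcas_last[OF p(2,4)] p(4) unfolding f_def by (simp add: last_conv_nth)
      with True show ?thesis using pcas_nth[OF p(2) less[of "Suc i"]] by simp
    next
      case False
      then have "Suc i mod ?n = Suc (i mod ?n)" by (simp add: mod_Suc split: if_splits)
      then show ?thesis using pcas_nth[OF p(2) less[of "Suc i"]] unfolding f_def by simp
    qed
    then have "(f i, f (Suc i)) = p ! (Suc i mod ?n)" unfolding f_def by (simp add: prod_eq_iff)
    then show ?thesis using p(1) less[of "Suc i"] by (metis nth_mem subsetD)
  qed
  ultimately show thesis using that by blast
qed

text \<open>Zipping a vertex list with its own tail yields its arcs, as \<open>zip\<close> cuts off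
  the last vertex of the longer list.\<close>

lemma awalk_zip:
  assumes "successively (\<lambda>u v. (u, v) \<in> parcs G) (u # vs)" "u \<in> pverts G"
  shows "pre_digraph.awalk (with_proj G) u (zip (u # vs) vs) (last (u # vs))"
    and "pre_digraph.awalk_verts (with_proj G) u (zip (u # vs) vs) = u # vs"
proof -
  have arcs: "set (zip (u # vs) vs) \<subseteq> parcs G"
    using assms(1)
  proof (induction vs arbitrary: u)
    case (Cons v vs)
    from Cons.IH[of v] Cons.prems show ?case by (cases vs) auto
  qed simp
  have cas: "pcas u (zip (u # vs) vs) (last (u # vs))"
  proof (induction vs arbitrary: u)
    case (Cons v vs)
    from Cons.IH[of v] show ?case by simp
  qed simp
  show "pre_digraph.awalk (with_proj G) u (zip (u # vs) vs) (last (u # vs))"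
    unfolding pre_digraph.awalk_def cas_with_proj_eq using arcs cas assms(2) by simp
  show "pre_digraph.awalk_verts (with_proj G) u (zip (u # vs) vs) = u # vs"
    unfolding awalk_verts_with_proj_eq pawalk_verts_conv[OF cas] by (simp add: map_snd_zip_take)
qed

text \<open>The closed walk starts at \<open>last vs\<close>, so its vertex list without the start
  is exactly \<open>vs\<close>, and this is the list that a cycle must have distinct.\<close>

lemma cycle_spectrumI:
  assumes "distinct vs" "3 \<le> length vs" "last vs \<in> pverts G"
    and "successively (\<lambda>u v. (u, v) \<in> parcs G) (last vs # vs)"
  shows "length vs \<in> cycle_spectrum (with_proj G)"
proof -
  let ?p = "zip (last vs # vs) vs"
  have vs: "vs \<noteq> []" using assms(2) by auto
  have "pre_digraph.cycle (with_proj G) ?p"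
    unfolding pre_digraph.cycle_def
    using awalk_zip[OF assms(4,3)] assms(1) vs by (intro exI[of _ "last vs"]) (simp add: neq_Nil_conv)
  moreover have "length ?p = length vs" by simp
  ultimately show ?thesis
    unfolding cycle_spectrum_def using assms(2) by (intro CollectI exI[of _ ?p]) simp
qed

section \<open>Paths in the strip\<close>

abbreviation up :: "bool \<Rightarrow> int \<Rightarrow> int \<Rightarrow> (int \<times> bool) list" where
  "up s a b \<equiv> map (\<lambda>c. (c, s)) [a..b]"

abbreviation down :: "bool \<Rightarrow> int \<Rightarrow> int \<Rightarrow> (int \<times> bool) list" where
  "down s a b \<equiv> rev (up s a b)"

lemma hd_upto: "a \<le> b \<Longrightarrow> hd [a..b] = a"
  by (simp add: upto_rec1)

lemma last_upto: "a \<le> b \<Longrightarrow> last [a..b] = b"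
  by (simp add: upto_rec2)

lemma successively_up: "successively strip_adj (up s a b)"
proof (induction "nat (b - a + 1)" arbitrary: a)
  case (Suc n)
  then have IH: "successively strip_adj (up s (a + 1) b)" and ab: "a \<le> b" by simp_all
  show ?case
  proof (cases "a + 1 \<le> b")
    case True
    then have "hd (up s (a + 1) b) = (a + 1, s)" by (simp add: hd_map hd_upto)
    then show ?thesis
      using IH ab by (simp add: upto_rec1[of a b] successively_Cons strip_adj.simps)
  qed (use ab in \<open>simp add: upto_rec1\<close>)
qed simp

lemma successively_down: "successively strip_adj (down s a b)"
proof -
  have "(\<lambda>p q. strip_adj q p) = strip_adj" by (intro ext) (rule strip_adj_sym)
  then show ?thesis using successively_up by (simp only: successively_rev)
qed

lemma row_simps:
  assumes "a \<le> b"
  shows "hd (up s a b) = (a, s)" "last (up s a b) = (b, s)"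
    "hd (down s a b) = (b, s)" "last (down s a b) = (a, s)" "[a..b] \<noteq> []"
  using assms by (simp_all add: hd_map last_map hd_upto last_upto hd_rev last_rev)

text \<open>Gluing of walks: the second walk is \<open>x # ys\<close> with its start
  \<open>x\<close> shared, so nothing is repeated and \<open>ys\<close> may be empty.\<close>

lemma successively_append_chain:
  assumes "successively P xs" "xs \<noteq> []" "last xs = x" "successively P (x # ys)" "last (x # ys) = y"
  shows "successively P (xs @ ys)" "last (xs @ ys) = y"
  using assms by (auto simp: successively_append_iff successively_Cons)

text \<open>Induction on the number of periods; one period can be crossed with 3, 4, 5 or 6 new
  vertices, returning to row \<open>s\<close>. The start is not in \<open>xs\<close> and the end is,
  so such chains concatenate and close up around the ring.\<close>

lemma single_chain:
  assumes "3 * m \<le> n" "n \<le> 6 * m"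
  shows "\<exists>xs. length xs = n \<and> distinct xs \<and> set xs \<subseteq> {3 * a + 1..3 * a + 3 * int m} \<times> UNIV
    \<and> successively strip_adj ((3 * a, s) # xs) \<and> last ((3 * a, s) # xs) = (3 * a + 3 * int m, s)"
  using assms
proof (induction m arbitrary: n)
  case (Suc m)
  \<comment> \<open>The last period takes 3 vertices if the others can absorb the rest, and
    otherwise \<open>n - 6 * m\<close>.\<close>
  obtain l where l: "l \<in> {3, 4, 5, 6}" "l \<le> n" "3 * m \<le> n - l" "n - l \<le> 6 * m"
  proof -
    have "n \<le> 6 * m + 3 \<or> n = 6 * m + 4 \<or> n = 6 * m + 5 \<or> n = 6 * m + 6"
      using Suc.prems by presburger
    then consider "n \<le> 6 * m + 3" | "n = 6 * m + 4" | "n = 6 * m + 5" | "n = 6 * m + 6" by blast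
    then show thesis
      using Suc.prems by cases (rule that[of 3] that[of 4] that[of 5] that[of 6]; simp)+
  qed
  define c where "c = 3 * a + 3 * int m"
  obtain xs where xs: "length xs = n - l" "distinct xs" "set xs \<subseteq> {3 * a + 1..c} \<times> UNIV"
    "successively strip_adj ((3 * a, s) # xs)" "last ((3 * a, s) # xs) = (c, s)"
    using Suc.IH[OF l(3,4)] unfolding c_def by blast
  have mods: "c mod 3 = 0" "(c + 1) mod 3 = 1" "(c + 2) mod 3 = 2" "(c + 3) mod 3 = 0"
    unfolding c_def by presburger+
  \<comment> \<open>Two independent detours: the rung in column \<open>c + 1\<close> costs one extra
    vertex, and three edges instead of one of the 4-cycle on columns \<open>c + 2\<close>,
    \<open>c + 3\<close> cost two.\<close>
  define ys where "ys =
    (if l = 3 then [(c + 1, s), (c + 2, s), (c + 3, s)]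
     else if l = 4 then [(c + 1, s), (c + 1, \<not> s), (c + 2, \<not> s), (c + 3, s)]
     else if l = 5 then [(c + 1, s), (c + 2, s), (c + 3, \<not> s), (c + 2, \<not> s), (c + 3, s)]
     else [(c + 1, s), (c + 1, \<not> s), (c + 2, \<not> s), (c + 3, \<not> s), (c + 2, s), (c + 3, s)])"
  have "length ys = l" using l(1) unfolding ys_def by auto
  moreover have "distinct ys" "set ys \<subseteq> {c + 1..c + 3} \<times> UNIV" unfolding ys_def by auto
  moreover have "successively strip_adj ((c, s) # ys)" "last ((c, s) # ys) = (c + 3, s)"
    unfolding ys_def using mods by (auto simp: strip_adj.simps)
  ultimately have ys: "length ys = l" "distinct ys" "set ys \<subseteq> {c + 1..c + 3} \<times> UNIV"
    "successively strip_adj ((c, s) # ys)" "last ((c, s) # ys) = (c + 3, s)" by blast+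
  have "set xs \<inter> set ys = {}" using xs(3) ys(3) by fastforce
  moreover have "set xs \<union> set ys \<subseteq> {3 * a + 1..3 * a + 3 * int (Suc m)} \<times> UNIV"
    using xs(3) ys(3) unfolding c_def by fastforce
  moreover note successively_append_chain[OF xs(4) _ xs(5) ys(4,5)]
  ultimately show ?case
    using xs(1,2) ys(1,2) l(2) by (intro exI[of _ "xs @ ys"]) (simp add: c_def)
qed simp

text \<open>The longest chain has as many distinct vertices as the columns it stays in, so it fills
  them.\<close>

lemma full_chain:
  assumes "a \<le> b"
  obtains xs where "int (length xs) = 6 * (b - a)" "set xs = {3 * a + 1..3 * b} \<times> UNIV"
    "successively strip_adj ((3 * a, s) # xs)" "last ((3 * a, s) # xs) = (3 * b, s)"
proof -
  define m where "m = nat (b - a)"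
  have b: "3 * a + 3 * int m = 3 * b" using assms unfolding m_def by simp
  obtain xs where xs: "length xs = 6 * m" "distinct xs" "set xs \<subseteq> {3 * a + 1..3 * b} \<times> UNIV"
    "successively strip_adj ((3 * a, s) # xs)" "last ((3 * a, s) # xs) = (3 * b, s)"
    using single_chain[of m "6 * m" a s] unfolding b by auto
  have "card ({3 * a + 1..3 * b} \<times> (UNIV :: bool set)) = 6 * m"
    unfolding m_def by (simp add: card_cartesian_product)
  then have "set xs = {3 * a + 1..3 * b} \<times> UNIV"
    using xs(1-3) distinct_card[of xs] by (intro card_subset_eq) auto
  moreover have "int (length xs) = 6 * (b - a)" using xs(1) b by simp
  ultimately show thesis using xs(4,5) that by blast
qed

lemma mem_up: "(c, t) \<in> set (up s a b) \<longleftrightarrow> t = s \<and> a \<le> c \<and> c \<le> b"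
  by auto

section \<open>The quotient graph\<close>

text \<open>The quotient map by the translation. Halving the code recovers the column around the
  ring, its parity the row.\<close>

definition proj :: "nat \<Rightarrow> int \<times> bool \<Rightarrow> nat" where
  "proj k p = nat (2 * (fst p mod (3 * int k)) + of_bool (snd p))"

definition ring_graph :: "nat \<Rightarrow> nat pair_pre_digraph" where
  "ring_graph k = \<lparr>pverts = {..<6 * k}, parcs = {(proj k p, proj k q) | p q. strip_adj p q}\<rparr>"

text \<open>A Hamiltonian path of the quotient, represented by a lift to the strip:
  \<open>6 * k\<close> distinct images exhaust the vertices.\<close>

definition joined :: "nat \<Rightarrow> nat \<Rightarrow> nat \<Rightarrow> bool" where
  "joined k u v \<longleftrightarrow> (\<exists>xs. length xs = 6 * k \<and> distinct (map (proj k) xs) \<and> successively strip_adj xs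
     \<and> proj k (hd xs) = u \<and> proj k (last xs) = v)"

context
  fixes k :: nat
  assumes k: "2 \<le> k"
begin

lemma proj_eq_iff:
  "proj k p = proj k q \<longleftrightarrow> fst p mod (3 * int k) = fst q mod (3 * int k) \<and> snd p = snd q"
proof -
  have parity_neq: "2 * a + 1 \<noteq> 2 * b" "2 * b \<noteq> 2 * a + 1" for a b :: int
    by presburger+
  have "0 \<le> c mod (3 * int k)" for c using k by simp
  then have "int (proj k p) = 2 * (fst p mod (3 * int k)) + of_bool (snd p)" for p
    unfolding proj_def by simp
  then show ?thesis
    unfolding of_nat_eq_iff[where 'a=int, symmetric]
    using parity_neq by (cases "snd p"; cases "snd q") simp_all
qed

lemma proj_less: "proj k p < 6 * k"
proof -
  have "fst p mod (3 * int k) < 3 * int k" using k by simp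
  then have "2 * (fst p mod (3 * int k)) + of_bool (snd p) < 6 * int k"
    by (cases "snd p") auto
  then show ?thesis unfolding proj_def using k by linarith
qed

text \<open>The two rows of the strip may be covered by different windows of \<open>3k\<close> columns.\<close>

lemma proj_surj_window:
  assumes "u < 6 * k"
  obtains c s where "u = proj k (c, s)" "a s \<le> c" "c < a s + 3 * int k"
proof -
  define s where "s = odd u"
  define c where "c = a s + (int (u div 2) - a s) mod (3 * int k)"
  have "c mod (3 * int k) = int (u div 2) mod (3 * int k)"
    unfolding c_def by (simp add: mod_add_right_eq)
  also have "\<dots> = int (u div 2)" using assms by auto
  finally have "proj k (c, s) = u"
    unfolding proj_def s_def by (cases "odd u") (auto elim: oddE simp: nat_add_distrib)
  moreover have "a s \<le> c" "c < a s + 3 * int k"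
    unfolding c_def using k by auto
  ultimately show thesis using that by blast
qed

lemma proj_surj: "u < 6 * k \<Longrightarrow> \<exists>p. u = proj k p"
  using proj_surj_window[of u "\<lambda>_. 0"] by metis

lemma inj_on_proj_window: "inj_on (proj k) ({a..<a + 3 * int k} \<times> UNIV)"
proof (rule inj_onI)
  fix p q assume pq: "p \<in> {a..<a + 3 * int k} \<times> UNIV" "q \<in> {a..<a + 3 * int k} \<times> UNIV"
    and "proj k p = proj k q"
  then have eq: "fst p mod (3 * int k) = fst q mod (3 * int k)" "snd p = snd q"
    by (auto simp: proj_eq_iff)
  then have "3 * int k dvd fst p - fst q" by (simp add: mod_eq_dvd_iff)
  moreover have "\<bar>fst p - fst q\<bar> < 3 * int k" using pq by auto
  ultimately have "fst p = fst q" using zdvd_not_zless[of "\<bar>fst p - fst q\<bar>" "3 * int k"] by auto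
  with eq show "p = q" by (simp add: prod_eq_iff)
qed

text \<open>The strip covers the ring: an arc lifts from any preimage of its tail, because a given
  lift can be translated by a multiple of \<open>3 * k\<close>, which preserves adjacency.\<close>

lemma ring_arc_lift:
  assumes "(proj k p, v) \<in> parcs (ring_graph k)"
  obtains q where "strip_adj p q" "v = proj k q"
proof -
  obtain p' q' where *: "proj k p = proj k p'" "v = proj k q'" "strip_adj p' q'"
    using assms unfolding ring_graph_def by auto
  then have "fst p mod (3 * int k) = fst p' mod (3 * int k)" and s: "snd p = snd p'"
    by (auto simp: proj_eq_iff)
  then have "3 * int k dvd fst p - fst p'" by (simp add: mod_eq_dvd_iff)
  then obtain m where m: "fst p = fst p' + 3 * int k * m" unfolding dvd_def by (auto simp: algebra_simps)
  let ?q = "(fst q' + 3 * int k * m, snd q')"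
  have "strip_adj (fst p' + 3 * int k * m, snd p') ?q"
    using *(3) by (subst strip_adj_shift) auto
  then have "strip_adj p ?q" using m s by (cases p) simp
  moreover have "v = proj k ?q" using * by (simp add: proj_eq_iff)
  ultimately show thesis using that by blast
qed

lemma ring_arcI: "strip_adj p q \<Longrightarrow> (proj k p, proj k q) \<in> parcs (ring_graph k)"
  unfolding ring_graph_def by (auto simp del: split_paired_Ex)

lemma pair_graph_ring: "pair_graph (ring_graph k)"
proof
  show "finite (parcs (ring_graph k))"
    by (rule finite_subset[of _ "{..<6 * k} \<times> {..<6 * k}"]) (auto simp: ring_graph_def proj_less)
  show "symmetric (with_proj (ring_graph k))"
    unfolding symmetric_def by (auto simp: ring_graph_def sym_def intro: strip_adj_sym[THEN iffD1])
  show "fst e \<noteq> snd e" if e: "e \<in> parcs (ring_graph k)" for e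
  proof
    assume eq: "fst e = snd e"
    obtain p where p: "fst e = proj k p" using e unfolding ring_graph_def by auto
    then have "(proj k p, proj k p) \<in> parcs (ring_graph k)" using e eq by (metis prod.collapse)
    then obtain q where q: "strip_adj p q" "proj k p = proj k q" by (rule ring_arc_lift)
    \<comment> \<open>A loop would lift to neighbours with equal image; they lie at most one column
      apart, so within one window where \<open>proj k\<close> is injective.\<close>
    have "p = q"
      using inj_on_proj_window[of "fst p - 1"] q(2)
    proof (rule inj_onD)
      show "p \<in> {fst p - 1..<fst p - 1 + 3 * int k} \<times> UNIV"
           "q \<in> {fst p - 1..<fst p - 1 + 3 * int k} \<times> UNIV"
        using strip_adj_fst[OF q(1)] k by (auto simp: mem_Times_iff)
    qed
    with q(1) show False by (simp add: strip_adj_irrefl)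
  qed
qed (auto simp: ring_graph_def proj_less)

text \<open>The three strip neighbours lie within three consecutive columns, so projection keeps
  them apart, and by lifting they give all out-arcs.\<close>

lemma cubic_ring: "cubic (with_proj (ring_graph k))"
  unfolding cubic_def
proof
  fix v assume "v \<in> verts (with_proj (ring_graph k))"
  then obtain p where v: "v = proj k p" using proj_surj[of v] unfolding ring_graph_def by (auto simp del: split_paired_Ex)
  let ?N = "{q. strip_adj p q}"
  have "out_arcs (with_proj (ring_graph k)) v = Pair v ` proj k ` ?N"
    unfolding out_arcs_def by (auto simp: v intro: ring_arcI elim!: ring_arc_lift)
  moreover have "inj_on (proj k) ?N"
  proof (rule inj_on_subset[OF inj_on_proj_window[of "fst p - 1"]])
    show "?N \<subseteq> {fst p - 1..<fst p - 1 + 3 * int k} \<times> UNIV"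
    proof
      fix q assume "q \<in> ?N"
      then show "q \<in> {fst p - 1..<fst p - 1 + 3 * int k} \<times> UNIV"
        using strip_adj_fst[of p q] k by (auto simp: mem_Times_iff)
    qed
  qed
  moreover have "inj_on (Pair v) A" for A :: "nat set" by (simp add: inj_on_def)
  ultimately show "out_degree (with_proj (ring_graph k)) v = 3"
    unfolding out_degree_def by (simp only: card_image card_strip_neighbours)
qed

section \<open>The cycle spectrum\<close>

lemma ring_arc_less: "(u, v) \<in> parcs (ring_graph k) \<Longrightarrow> u < 6 * k"
  using proj_less unfolding ring_graph_def by auto

text \<open>With fewer than \<open>3 * k\<close> vertices the cycle misses some column
  \<open>q\<close>. Cutting the ring there, each vertex has a unique lift in the window of
  \<open>3 * k\<close> columns from \<open>q\<close>, and the lifts form a cycle in the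
  strip.\<close>

lemma ring_cycle_length:
  fixes f :: "nat \<Rightarrow> nat"
  assumes n: "3 \<le> n" "n < 3 * k"
    and eq_iff: "\<And>i j. f i = f j \<longleftrightarrow> int n dvd int i - int j"
    and arc: "\<And>i. (f i, f (Suc i)) \<in> parcs (ring_graph k)"
  shows "n = 4 \<or> n mod 3 = 2"
proof -
  have "\<not> {..<3 * k} \<subseteq> (\<lambda>i. f i div 2) ` {..<n}"
  proof
    assume "{..<3 * k} \<subseteq> (\<lambda>i. f i div 2) ` {..<n}"
    from surj_card_le[OF _ this] n show False by simp
  qed
  then obtain q where q: "q < 3 * k" "q \<notin> (\<lambda>i. f i div 2) ` {..<n}" by auto
  have q': "f i div 2 \<noteq> q" for i
  proof -
    have "f i = f (i mod n)" by (simp add: eq_iff zmod_int minus_mod_eq_mult_div)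
    moreover have "i mod n < n" using n by simp
    ultimately show ?thesis using q(2) by auto
  qed
  have col: "proj k p div 2 = q" if "fst p = int q \<or> fst p = int q + 3 * int k" for p
  proof -
    have "fst p mod (3 * int k) = int q" using that q(1) by auto
    then show ?thesis unfolding proj_def by (cases "snd p") simp_all
  qed
  have "\<exists>p. f i = proj k p \<and> int q \<le> fst p \<and> fst p < int q + 3 * int k" for i
  proof -
    have "f i < 6 * k" using ring_arc_less arc by blast
    then show ?thesis using proj_surj_window[of "f i" "\<lambda>_. int q"] by (metis fst_conv)
  qed
  then obtain g where g: "\<And>i. f i = proj k (g i)" "\<And>i. int q \<le> fst (g i)" "\<And>i. fst (g i) < int q + 3 * int k"
    by metis
  have window: "p = g i" if "proj k p = f i" "int q \<le> fst p" "fst p < int q + 3 * int k" for p i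
    using inj_onD[OF inj_on_proj_window[of "int q"], of p "g i"] that g
    by (simp add: mem_Times_iff)
  show ?thesis
  proof (rule strip_cycle_length[OF n(1)])
    show "g i = g j \<longleftrightarrow> int n dvd int i - int j" for i j
      unfolding eq_iff[symmetric] using window[of "g i" j] g by metis
    show "strip_adj (g i) (g (Suc i))" for i
    proof -
      obtain p where p: "strip_adj (g i) p" "f (Suc i) = proj k p"
        using ring_arc_lift[of "g i" "f (Suc i)"] arc[of i] g(1) by metis
      \<comment> \<open>A step could leave the window only from column \<open>q\<close> or into
        column \<open>q + 3 * k\<close>; both project to the missed column.\<close>
      have "fst (g i) \<noteq> int q" using col[of "g i"] q'[of i] g(1)[of i] by auto
      moreover have "fst p \<noteq> int q" "fst p \<noteq> int q + 3 * int k"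
        using col[of p] q'[of "Suc i"] p(2) by auto
      ultimately have "p = g (Suc i)"
        using strip_adj_fst[OF p(1)] g(2,3)[of i] p(2) by (intro window) auto
      with p(1) show ?thesis by simp
    qed
  qed
qed

lemma cycle_spectrum_ring_subset:
  "cycle_spectrum (with_proj (ring_graph k)) \<subseteq> {4} \<union> {3 * m + 2 | m. m \<in> {1..k - 1}} \<union> {3 * k..6 * k}"
proof
  fix n assume "n \<in> cycle_spectrum (with_proj (ring_graph k))"
  then obtain p where p: "pre_digraph.cycle (with_proj (ring_graph k)) p" "3 \<le> n" "n = length p"
    unfolding cycle_spectrum_def by auto
  from p(1) obtain f
    where f: "\<And>i j. f i = f j \<longleftrightarrow> int n dvd int i - int j" "\<And>i. (f i, f (Suc i)) \<in> parcs (ring_graph k)"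
    unfolding p(3) by (rule cycleE) blast
  have "inj_on f {..<n}" by (rule inj_on_period[OF f(1)])
  moreover have "f ` {..<n} \<subseteq> {..<6 * k}"
    using ring_arc_less f(2) by blast
  ultimately have "n \<le> 6 * k" using card_inj_on_le[of f "{..<n}" "{..<6 * k}"] by simp
  show "n \<in> {4} \<union> {3 * m + 2 | m. m \<in> {1..k - 1}} \<union> {3 * k..6 * k}"
  proof (cases "n < 3 * k")
    case True
    then have "n = 4 \<or> n mod 3 = 2" using ring_cycle_length[OF p(2) _ f] by blast
    moreover have "n = 3 * (n div 3) + 2" if "n mod 3 = 2" using that by presburger
    moreover have "n div 3 \<in> {1..k - 1}" using True p(2) by auto
    ultimately show ?thesis by blast
  next
    case False
    with \<open>n \<le> 6 * k\<close> show ?thesis by simp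
  qed
qed

section \<open>Cycles of every length in the spectrum\<close>

lemma successively_proj:
  "successively strip_adj xs \<Longrightarrow> successively (\<lambda>u v. (u, v) \<in> parcs (ring_graph k)) (map (proj k) xs)"
  unfolding successively_map by (erule successively_mono) (erule ring_arcI)

text \<open>\<open>p\<close> is another lift of the last vertex: that vertex itself for a cycle
  closing in the strip, its translate for one running around the ring.\<close>

lemma ring_cycleI:
  assumes "distinct (map (proj k) xs)" "3 \<le> length xs"
    and "successively strip_adj (p # xs)" "proj k (last xs) = proj k p"
  shows "length xs \<in> cycle_spectrum (with_proj (ring_graph k))"
proof -
  have "xs \<noteq> []" using assms(2) by auto
  then have last: "last (map (proj k) xs) = proj k p" using assms(4) by (simp add: last_map)
  have "length (map (proj k) xs) \<in> cycle_spectrum (with_proj (ring_graph k))"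
  proof (rule cycle_spectrumI)
    show "last (map (proj k) xs) \<in> pverts (ring_graph k)"
      unfolding last using proj_less by (simp add: ring_graph_def)
    show "successively (\<lambda>u v. (u, v) \<in> parcs (ring_graph k)) (last (map (proj k) xs) # map (proj k) xs)"
      unfolding last using successively_proj[OF assms(3)] by simp
  qed (use assms in simp_all)
  then show ?thesis by simp
qed

lemma distinct_projI:
  assumes "distinct xs" "set xs \<subseteq> {a..<a + 3 * int k} \<times> UNIV"
  shows "distinct (map (proj k) xs)"
  using assms inj_on_subset[OF inj_on_proj_window] by (auto simp: distinct_map)

lemma four_in_cycle_spectrum: "4 \<in> cycle_spectrum (with_proj (ring_graph k))"
proof -
  \<comment> \<open>The complete join of columns 2 and 3 is itself a 4-cycle.\<close>
  have "length [(3 :: int, True), (2, False), (3, False), (2, True)] \<in> cycle_spectrum (with_proj (ring_graph k))"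
  proof (rule ring_cycleI[where p = "(2, True)"])
    show "distinct (map (proj k) [(3 :: int, True), (2, False), (3, False), (2, True)])"
      by (rule distinct_projI[where a = 2]) (use k in auto)
  qed (simp_all add: strip_adj.simps)
  then show ?thesis by (simp add: eval_nat_numeral)
qed

text \<open>Out along one row and back along the other, closed by the rung in column 1. For even
  \<open>m\<close> the far end is the rung in column \<open>3 * t + 1\<close>, giving
  \<open>6 * t + 2\<close> vertices; for odd \<open>m\<close> it is the diagonal from column
  \<open>3 * t + 3\<close> to \<open>3 * t + 2\<close>, giving \<open>6 * t + 5\<close>.\<close>

lemma contractible_in_cycle_spectrum:
  assumes "1 \<le> m" "m \<le> k - 1"
  shows "3 * m + 2 \<in> cycle_spectrum (with_proj (ring_graph k))"
proof -
  define t where "t = int m div 2"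
  define r where "r = (if even m then 3 * t + 1 else 3 * t + 3)"
  define r' where "r' = (if even m then 3 * t + 1 else 3 * t + 2)"
  let ?xs = "up True 1 r @ down False 1 r'"
  have m: "int m = (if even m then 2 * t else 2 * t + 1)" and "0 \<le> t"
    unfolding t_def by presburger+
  have bounds: "1 \<le> r" "r \<le> 3 * int k" "1 \<le> r'" "r' \<le> 3 * int k"
    using m \<open>0 \<le> t\<close> assms k unfolding r_def r'_def by (auto split: if_splits)
  have ends: "hd (up True 1 r) = (1, True)" "last (up True 1 r) = (r, True)" "up True 1 r \<noteq> []"
    "hd (down False 1 r') = (r', False)" "last (down False 1 r') = (1, False)" "down False 1 r' \<noteq> []"
    using bounds row_simps(1,2)[of 1 r True] row_simps(3,4)[of 1 r' False] by simp_all
  have mods: "(3 * t + 1) mod 3 = 1" "(3 * t + 2) mod 3 = 2" by presburger+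
  have "strip_adj (r, True) (r', False)"
    unfolding r_def r'_def by (cases "even m") (simp_all add: strip_adj.simps mods)
  moreover have "strip_adj (1, False) (1, True)" by (simp add: strip_adj.simps)
  ultimately have succ: "successively strip_adj ((1, False) # ?xs)"
    unfolding successively_Cons successively_append_iff
    using ends successively_up successively_down by (simp only: hd_append) simp
  have "int (length ?xs) = int (3 * m + 2)"
    using bounds m unfolding r_def r'_def by (cases "even m") simp_all
  then have len: "length ?xs = 3 * m + 2" by (simp only: of_nat_eq_iff)
  have "length ?xs \<in> cycle_spectrum (with_proj (ring_graph k))"
  proof (rule ring_cycleI[OF _ _ succ])
    show "distinct (map (proj k) ?xs)"
    proof (rule distinct_projI[where a = 1])
      show "distinct ?xs" by (auto simp: distinct_map inj_on_def)
      show "set ?xs \<subseteq> {1..<1 + 3 * int k} \<times> UNIV" using bounds by auto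
    qed
    show "proj k (last ?xs) = proj k (1, False)"
      using ends by (simp only: last_append) simp
    show "3 \<le> length ?xs" unfolding len using assms by simp
  qed
  then show ?thesis unfolding len .
qed

text \<open>A chain across \<open>k\<close> periods closes up, as columns 0 and \<open>3 * k\<close>
  are identified.\<close>

lemma noncontractible_in_cycle_spectrum:
  assumes "3 * k \<le> n" "n \<le> 6 * k"
  shows "n \<in> cycle_spectrum (with_proj (ring_graph k))"
proof -
  obtain xs where xs: "length xs = n" "distinct xs" "set xs \<subseteq> {1..3 * int k} \<times> UNIV"
    "successively strip_adj ((0, True) # xs)" "last ((0, True) # xs) = (3 * int k, True)"
    using single_chain[OF assms, of 0 True] by auto
  have "length xs \<in> cycle_spectrum (with_proj (ring_graph k))"
  proof (rule ring_cycleI[OF _ _ xs(4)])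
    show "distinct (map (proj k) xs)"
      using xs(2,3) by (intro distinct_projI[where a = 1]) auto
    have "xs \<noteq> []" using xs(1) assms k by auto
    then show "proj k (last xs) = proj k (0, True)"
      using xs(5) by (simp add: proj_eq_iff)
    show "3 \<le> length xs" using xs(1) assms k by simp
  qed
  with xs(1) show ?thesis by simp
qed

lemma cycle_spectrum_ring:
  "cycle_spectrum (with_proj (ring_graph k)) = {4} \<union> {3 * m + 2 | m. m \<in> {1..k - 1}} \<union> {3 * k..6 * k}"
proof (rule equalityI[OF cycle_spectrum_ring_subset], rule subsetI)
  fix n assume "n \<in> {4} \<union> {3 * m + 2 | m. m \<in> {1..k - 1}} \<union> {3 * k..6 * k}"
  then consider "n = 4" | m where "n = 3 * m + 2" "1 \<le> m" "m \<le> k - 1" | "3 * k \<le> n" "n \<le> 6 * k"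
    by fastforce
  then show "n \<in> cycle_spectrum (with_proj (ring_graph k))"
  proof cases
    case 1
    then show ?thesis using four_in_cycle_spectrum by simp
  next
    case 2
    then show ?thesis using contractible_in_cycle_spectrum by simp
  next
    case 3
    then show ?thesis by (rule noncontractible_in_cycle_spectrum)
  qed
qed

section \<open>Hamiltonian paths\<close>

text \<open>Distinctness comes from counting: \<open>6 * k\<close> entries whose images cover all
  \<open>6 * k\<close> vertices. Each row may be covered in its own window, so the list may go past
  one lap.\<close>

lemma joinedI:
  assumes "successively strip_adj xs" "last xs = q" "hd xs = p" "length xs = 6 * k"
    and rows: "\<And>c. a \<le> c \<Longrightarrow> c < a + 3 * int k \<Longrightarrow> (c, s) \<in> set xs"
      "\<And>c. b \<le> c \<Longrightarrow> c < b + 3 * int k \<Longrightarrow> (c, \<not> s) \<in> set xs"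
  shows "joined k (proj k p) (proj k q)"
proof -
  have "u \<in> proj k ` set xs" if u: "u < 6 * k" for u
  proof -
    obtain c t where *: "u = proj k (c, t)" "(if t = s then a else b) \<le> c"
      "c < (if t = s then a else b) + 3 * int k"
      using proj_surj_window[OF u, of "\<lambda>t. if t = s then a else b"] by metis
    then have "(c, t) \<in> set xs"
      using rows[of c] by (cases "t = s") auto
    with *(1) show ?thesis by blast
  qed
  then have "{..<6 * k} \<subseteq> set (map (proj k) xs)" unfolding set_map by blast
  then have "card {..<6 * k} \<le> card (set (map (proj k) xs))" by (rule card_mono[OF finite_set])
  then have "card (set (map (proj k) xs)) = length (map (proj k) xs)"
    using assms(4) card_length[of "map (proj k) xs"] by simp
  then have "distinct (map (proj k) xs)" by (rule card_distinct)
  with assms(1-4) show ?thesis unfolding joined_def by (intro exI[of _ xs]) simp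
qed

lemma joined_sym: "joined k u v \<Longrightarrow> joined k v u"
proof -
  assume "joined k u v"
  then obtain xs where xs: "length xs = 6 * k" "distinct (map (proj k) xs)" "successively strip_adj xs"
    "proj k (hd xs) = u" "proj k (last xs) = v"
    unfolding joined_def by blast
  have "successively strip_adj (rev xs)"
    using xs(3) unfolding successively_rev by (rule successively_mono) (simp add: strip_adj_sym)
  moreover have "distinct (map (proj k) (rev xs))" using xs(2) by (simp add: rev_map[symmetric])
  moreover have "xs \<noteq> []" using xs(1) k by auto
  ultimately show ?thesis
    using xs unfolding joined_def by (intro exI[of _ "rev xs"]) (simp add: hd_rev last_rev)
qed

text \<open>\<open>h\<close> preserves adjacency and descends to an injective map of the quotient,
  so it carries Hamiltonian paths to Hamiltonian paths.\<close>

lemma joined_map: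
  assumes adj: "\<And>p q. strip_adj p q \<Longrightarrow> strip_adj (h p) (h q)"
    and proj: "\<And>p q. proj k (h p) = proj k (h q) \<longleftrightarrow> proj k p = proj k q"
    and "joined k (proj k p) (proj k q)"
  shows "joined k (proj k (h p)) (proj k (h q))"
proof -
  obtain xs where xs: "length xs = 6 * k" "distinct (map (proj k) xs)" "successively strip_adj xs"
    "proj k (hd xs) = proj k p" "proj k (last xs) = proj k q"
    using assms(3) unfolding joined_def by blast
  have "successively strip_adj (map h xs)"
    unfolding successively_map using xs(3) by (rule successively_mono) (rule adj)
  moreover have "distinct (map (proj k) (map h xs))"
    using xs(2) by (simp add: distinct_map inj_on_def proj)
  moreover have "xs \<noteq> []" using xs(1) k by auto
  ultimately show ?thesis
    using xs unfolding joined_def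
    by (intro exI[of _ "map h xs"]) (simp add: hd_map last_map proj)
qed

lemma joined_shift:
  assumes "joined k (proj k (c, s)) (proj k (d, t))"
  shows "joined k (proj k (c + 3 * a, s)) (proj k (d + 3 * a, t))"
proof -
  have "(c + 3 * a) mod (3 * int k) = (d + 3 * a) mod (3 * int k) \<longleftrightarrow> c mod (3 * int k) = d mod (3 * int k)"
    for c d by (simp add: mod_eq_dvd_iff)
  then show ?thesis
    using joined_map[of "\<lambda>(c, s). (c + 3 * a, s)" "(c, s)" "(d, t)"] assms
    by (simp add: proj_eq_iff strip_adj_shift split_beta)
qed

lemma joined_reflect:
  assumes "joined k (proj k (c, s)) (proj k (d, t))"
  shows "joined k (proj k (2 - c, s)) (proj k (2 - d, t))"
proof -
  have "(2 - c) mod (3 * int k) = (2 - d) mod (3 * int k) \<longleftrightarrow> c mod (3 * int k) = d mod (3 * int k)"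
    for c d :: int by (simp add: mod_eq_dvd_iff dvd_diff_commute)
  then show ?thesis
    using joined_map[of "\<lambda>(c, s). (2 - c, s)" "(c, s)" "(d, t)"] assms
    by (simp add: proj_eq_iff strip_adj_reflect split_beta)
qed

text \<open>Exchanging the two rows within a single block \<open>3i, 3i+1, 3i+2\<close> is an automorphism, since
  the columns \<open>3i-1, 3i\<close> and \<open>3i+2, 3i+3\<close> are completely joined. Hence the rows of two end points
  in different blocks do not matter.\<close>

lemma joined_twist:
  assumes "joined k (proj k (c, s)) (proj k (d, t))"
    and "(c div 3) mod int k \<noteq> (d div 3) mod int k"
  shows "joined k (proj k (c, s')) (proj k (d, t'))"
proof -
  \<comment> \<open>Depending on the block modulo \<open>k\<close> only, the exchange descends to
    the ring. The block of \<open>c\<close> gets the change from \<open>s\<close> to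
    \<open>s'\<close>, all other blocks, including that of \<open>d\<close>, the change from
    \<open>t\<close> to \<open>t'\<close>.\<close>
  define e where "e b \<longleftrightarrow> (if b mod int k = (c div 3) mod int k then s \<noteq> s' else t \<noteq> t')" for b
  let ?h = "\<lambda>p. (fst p, snd p \<noteq> e (fst p div 3))"
  have e_cong: "e (x div 3) = e (y div 3)" if "x mod (3 * int k) = y mod (3 * int k)" for x y
  proof -
    have "3 * int k dvd x - y" using that by (simp add: mod_eq_dvd_iff)
    then obtain m where "x - y = 3 * int k * m" by (elim dvdE)
    then have "x = y + 3 * (int k * m)" by simp
    then have "x div 3 = y div 3 + int k * m" by simp
    then show ?thesis unfolding e_def by simp
  qed
  have "proj k (?h p) = proj k (?h q) \<longleftrightarrow> proj k p = proj k q" for p q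
  proof (cases "fst p mod (3 * int k) = fst q mod (3 * int k)")
    case True
    then show ?thesis using e_cong[OF True] by (auto simp: proj_eq_iff)
  qed (simp add: proj_eq_iff)
  moreover have "strip_adj (?h p) (?h q)" if "strip_adj p q" for p q
    using strip_adj_twist[of "fst p" "snd p" e "fst q" "snd q"] that by simp
  ultimately have "joined k (proj k (?h (c, s))) (proj k (?h (d, t)))"
    by (intro joined_map[where h = ?h, OF _ _ assms(1)])
  moreover have "(s \<noteq> e (c div 3)) = s'" "(t \<noteq> e (d div 3)) = t'"
    using assms(2) unfolding e_def by auto
  ultimately show ?thesis by simp
qed

section \<open>Explicit Hamiltonian paths, named by the residues of the end columns modulo 3\<close>

text \<open>Down row \<open>\<not> s\<close> to the rung in column 1, back up row \<open>s\<close>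
  to column \<open>3 * j\<close>, then a full chain through the remaining columns.\<close>

lemma joined_00:
  assumes "1 \<le> j" "j < int k"
  shows "joined k (proj k (3 * j, \<not> s)) (proj k (3 * int k, s))"
proof -
  obtain ys where ys: "int (length ys) = 6 * (int k - j)" "set ys = {3 * j + 1..3 * int k} \<times> UNIV"
    "successively strip_adj ((3 * j, s) # ys)" "last ((3 * j, s) # ys) = (3 * int k, s)"
    using full_chain[of j "int k" s] assms(2) by (metis less_imp_le)
  let ?zs = "down (\<not> s) 1 (3 * j) @ up s 1 (3 * j)"
  have "1 \<le> 3 * j" using assms(1) by simp
  note rows = row_simps[OF this]
  have "strip_adj (1, \<not> s) (1, s)" by (simp add: strip_adj.simps)
  then have zs: "successively strip_adj ?zs"
    unfolding successively_append_iff using rows successively_up successively_down by simp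
  have ends: "?zs \<noteq> []" "hd ?zs = (3 * j, \<not> s)" "last ?zs = (3 * j, s)"
    using rows by simp_all
  note chain = successively_append_chain[OF zs ends(1,3) ys(3,4)]
  show ?thesis
  proof (rule joinedI[OF chain, where a = 1 and b = 1 and s = s])
    have "int (length (?zs @ ys)) = int (6 * k)" using ys(1) assms by simp
    then show "length (?zs @ ys) = 6 * k" by (simp only: of_nat_eq_iff)
    show "hd (?zs @ ys) = (3 * j, \<not> s)" using ends(1,2) by (simp only: hd_append) simp
  next
    fix c assume "1 \<le> c" "c < 1 + 3 * int k"
    then show "(c, s) \<in> set (?zs @ ys)" "(c, \<not> s) \<in> set (?zs @ ys)"
      unfolding set_append set_rev Un_iff mem_up ys(2) by auto
  qed
qed

text \<open>Down row \<open>s\<close> to column 1, over the rung, up row \<open>\<not> s\<close> to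
  column \<open>3 * j + 3\<close>, diagonally back for the skipped \<open>(3 * j + 2, s)\<close> and
  \<open>(3 * j + 3, s)\<close>, then a full chain.\<close>

lemma joined_10:
  assumes "0 \<le> j" "j < int k"
  shows "joined k (proj k (3 * j + 1, s)) (proj k (3 * int k, s))"
proof -
  obtain ys where ys: "int (length ys) = 6 * (int k - (j + 1))"
    "set ys = {3 * (j + 1) + 1..3 * int k} \<times> UNIV"
    "successively strip_adj ((3 * (j + 1), s) # ys)" "last ((3 * (j + 1), s) # ys) = (3 * int k, s)"
    using full_chain[of "j + 1" "int k" s] assms(2) by (metis zless_imp_add1_zle)
  let ?zs = "down s 1 (3 * j + 1) @ up (\<not> s) 1 (3 * j + 3) @ [(3 * j + 2, s), (3 * j + 3, s)]"
  have "1 \<le> 3 * j + 1" "1 \<le> 3 * j + 3" using assms(1) by simp_all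
  note rows = this[THEN row_simps(1)] this[THEN row_simps(2)] this[THEN row_simps(3)]
    this[THEN row_simps(4)] this[THEN row_simps(5)]
  have mods: "(3 * j + 2) mod 3 = 2" by presburger
  have "strip_adj (1, s) (1, \<not> s)" "strip_adj (3 * j + 3, \<not> s) (3 * j + 2, s)"
    "strip_adj (3 * j + 2, s) (3 * j + 3, s)"
    by (simp_all add: strip_adj.simps mods)
  then have zs: "successively strip_adj ?zs"
    unfolding successively_append_iff using rows successively_up successively_down by simp
  have ends: "?zs \<noteq> []" "hd ?zs = (3 * j + 1, s)" "last ?zs = (3 * (j + 1), s)"
    using rows by simp_all
  note chain = successively_append_chain[OF zs ends(1,3) ys(3,4)]
  show ?thesis
  proof (rule joinedI[OF chain, where a = 1 and b = 1 and s = s])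
    have "int (length (?zs @ ys)) = int (6 * k)" using ys(1) assms by simp
    then show "length (?zs @ ys) = 6 * k" by (simp only: of_nat_eq_iff)
    show "hd (?zs @ ys) = (3 * j + 1, s)" using ends(1,2) by (simp only: hd_append) simp
  next
    fix c assume "1 \<le> c" "c < 1 + 3 * int k"
    moreover have "c \<le> 3 * j + 1 \<or> c = 3 * j + 2 \<or> c = 3 * j + 3 \<or> 3 * (j + 1) + 1 \<le> c" by presburger
    ultimately show "(c, s) \<in> set (?zs @ ys)" "(c, \<not> s) \<in> set (?zs @ ys)"
      unfolding set_append set_rev Un_iff mem_up ys(2) by auto
  qed
qed

text \<open>Both ends lie in one block, so no twist can change the row. Instead the first period is
  crossed so as to leave it in row \<open>\<not> s\<close>.\<close>

lemma joined_10_same_block: "joined k (proj k (1, s)) (proj k (3 * int k, \<not> s))"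
proof -
  have "1 \<le> int k" using k by simp
  then obtain ys where ys: "int (length ys) = 6 * (int k - 1)" "set ys = {3 * 1 + 1..3 * int k} \<times> UNIV"
    "successively strip_adj ((3 * 1, \<not> s) # ys)" "last ((3 * 1, \<not> s) # ys) = (3 * int k, \<not> s)"
    by (rule full_chain)
  let ?zs = "[(1, s), (1, \<not> s), (2, \<not> s), (3 :: int, s), (2, s), (3, \<not> s)]"
  have zs: "successively strip_adj ?zs" by (simp add: strip_adj.simps)
  have ends: "?zs \<noteq> []" "hd ?zs = (1, s)" "last ?zs = (3 * 1, \<not> s)" by simp_all
  note chain = successively_append_chain[OF zs ends(1,3) ys(3,4)]
  show ?thesis
  proof (rule joinedI[OF chain, where a = 1 and b = 1 and s = s])
    have "int (length (?zs @ ys)) = int (6 * k)" using ys(1) by simp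
    then show "length (?zs @ ys) = 6 * k" by (simp only: of_nat_eq_iff)
    show "hd (?zs @ ys) = (1, s)" by simp
  next
    fix c assume "1 \<le> c" "c < 1 + 3 * int k"
    moreover from this have "c = 1 \<or> c = 2 \<or> c = 3 \<or> 3 * 1 + 1 \<le> c" by presburger
    ultimately show "(c, s) \<in> set (?zs @ ys)" "(c, \<not> s) \<in> set (?zs @ ys)"
      unfolding set_append Un_iff ys(2) by auto
  qed
qed

text \<open>Built from \<open>(1, \<not> s)\<close>: up row \<open>\<not> s\<close> to column
  \<open>3 * j + 3\<close>, diagonally back into row \<open>s\<close>, a full chain to column
  \<open>3 * k\<close>, then on along row \<open>s\<close> into the second lap. Hence the window of
  row \<open>s\<close> starts at \<open>3 * j + 2\<close>.\<close>

lemma joined_11: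
  assumes "0 \<le> j" "j < int k"
  shows "joined k (proj k (3 * int k + 3 * j + 1, s)) (proj k (1, \<not> s))"
proof -
  obtain ys where ys: "int (length ys) = 6 * (int k - (j + 1))"
    "set ys = {3 * (j + 1) + 1..3 * int k} \<times> UNIV"
    "successively strip_adj ((3 * (j + 1), s) # ys)" "last ((3 * (j + 1), s) # ys) = (3 * int k, s)"
    using full_chain[of "j + 1" "int k" s] assms(2) by (metis zless_imp_add1_zle)
  let ?zs = "up (\<not> s) 1 (3 * j + 3) @ [(3 * j + 2, s), (3 * j + 3, s)]"
  let ?us = "up s (3 * int k + 1) (3 * int k + 3 * j + 1)"
  have "1 \<le> 3 * j + 3" "3 * int k + 1 \<le> 3 * int k + 3 * j + 1" using assms(1) by simp_all
  note rows = this[THEN row_simps(1)] this[THEN row_simps(2)] this[THEN row_simps(5)]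
  have mods: "(3 * j + 2) mod 3 = 2" by presburger
  have "strip_adj (3 * j + 3, \<not> s) (3 * j + 2, s)" "strip_adj (3 * j + 2, s) (3 * j + 3, s)"
    by (simp_all add: strip_adj.simps mods)
  then have zs: "successively strip_adj ?zs"
    unfolding successively_append_iff using rows successively_up by simp
  have ends: "?zs \<noteq> []" "hd ?zs = (1, \<not> s)" "last ?zs = (3 * (j + 1), s)"
    using rows by simp_all
  note chain = successively_append_chain[OF zs ends(1,3) ys(3,4)]
  have us: "successively strip_adj ((3 * int k, s) # ?us)"
    "last ((3 * int k, s) # ?us) = (3 * int k + 3 * j + 1, s)"
    using rows successively_up by (simp_all add: successively_Cons strip_adj.simps)
  have "?zs @ ys \<noteq> []" using ends(1) by simp
  note chain' = successively_append_chain[OF chain(1) this chain(2) us]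
  show ?thesis
  proof (rule joined_sym, rule joinedI[OF chain', where a = "3 * j + 2" and b = 1 and s = s])
    have "int (length ((?zs @ ys) @ ?us)) = int (6 * k)" using ys(1) assms by simp
    then show "length ((?zs @ ys) @ ?us) = 6 * k" by (simp only: of_nat_eq_iff)
    show "hd ((?zs @ ys) @ ?us) = (1, \<not> s)" using ends(1,2) by (simp only: hd_append) simp
  next
    fix c assume "1 \<le> c" "c < 1 + 3 * int k"
    moreover have "c \<le> 3 * j + 3 \<or> 3 * (j + 1) + 1 \<le> c" by presburger
    ultimately show "(c, \<not> s) \<in> set ((?zs @ ys) @ ?us)"
      unfolding set_append Un_iff mem_up ys(2) by auto
  next
    fix c assume "3 * j + 2 \<le> c" "c < 3 * j + 2 + 3 * int k"
    moreover from this have "c = 3 * j + 2 \<or> c = 3 * j + 3 \<or> 3 * (j + 1) + 1 \<le> c" by presburger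
    moreover have "c \<le> 3 * int k \<or> 3 * int k + 1 \<le> c" by linarith
    ultimately show "(c, s) \<in> set ((?zs @ ys) @ ?us)"
      unfolding set_append Un_iff mem_up ys(2) by auto
  qed
qed

text \<open>Built from \<open>(0, s)\<close>: a full chain to column \<open>3 * j\<close>, the rung
  in the next column, row \<open>\<not> s\<close> up to column \<open>3 * k\<close>, and row
  \<open>s\<close> back. The turn skips \<open>(3 * k, s)\<close>, which is the start again.\<close>

lemma joined_02:
  assumes "0 \<le> j" "j < int k"
  shows "joined k (proj k (3 * j + 2, s)) (proj k (0, s))"
proof -
  obtain ys where ys: "int (length ys) = 6 * (j - 0)" "set ys = {3 * 0 + 1..3 * j} \<times> UNIV"
    "successively strip_adj ((3 * 0, s) # ys)" "last ((3 * 0, s) # ys) = (3 * j, s)"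
    using full_chain[of 0 j s] assms(1) by metis
  let ?us = "(3 * j + 1, s) # up (\<not> s) (3 * j + 1) (3 * int k) @ down s (3 * j + 2) (3 * int k - 1)"
  have "3 * j + 1 \<le> 3 * int k" "3 * j + 2 \<le> 3 * int k - 1" using assms(2) by simp_all
  note rows = this[THEN row_simps(1)] this[THEN row_simps(2)] this[THEN row_simps(3)]
    this[THEN row_simps(4)] this[THEN row_simps(5)]
  have mods: "(3 * j + 1) mod 3 = 1" "(3 * int k - 1) mod 3 = 2" by presburger+
  have "strip_adj (3 * j, s) (3 * j + 1, s)" "strip_adj (3 * j + 1, s) (3 * j + 1, \<not> s)"
    "strip_adj (3 * int k, \<not> s) (3 * int k - 1, s)"
    by (simp_all add: strip_adj.simps mods)
  then have us: "successively strip_adj ((3 * j, s) # ?us)" "last ((3 * j, s) # ?us) = (3 * j + 2, s)"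
    using rows successively_up successively_down
    by (simp_all add: successively_Cons successively_append_iff)
  note chain = successively_append_chain[OF ys(3) _ ys(4) us]
  show ?thesis
  proof (rule joined_sym, rule joinedI[OF chain, where a = 0 and b = 1 and s = s])
    have "int (length (((3 * 0, s) # ys) @ ?us)) = int (6 * k)" using ys(1) assms by simp
    then show "length (((3 * 0, s) # ys) @ ?us) = 6 * k" by (simp only: of_nat_eq_iff)
    show "hd (((3 * 0, s) # ys) @ ?us) = (0, s)" by simp
  next
    fix c assume "0 \<le> c" "c < 0 + 3 * int k"
    moreover from this have "c = 0 \<or> 3 * 0 + 1 \<le> c" by presburger
    moreover have "c \<le> 3 * j \<or> c = 3 * j + 1 \<or> 3 * j + 2 \<le> c" by presburger
    ultimately show "(c, s) \<in> set (((3 * 0, s) # ys) @ ?us)"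
      unfolding set_append set_simps insert_iff set_rev Un_iff mem_up ys(2) by auto
  next
    fix c assume "1 \<le> c" "c < 1 + 3 * int k"
    moreover have "c \<le> 3 * j \<or> 3 * j + 1 \<le> c" by presburger
    ultimately show "(c, \<not> s) \<in> set (((3 * 0, s) # ys) @ ?us)"
      unfolding set_append set_simps insert_iff set_rev Un_iff mem_up ys(2) by auto
  qed simp_all
qed

lemma joined_00_same_block: "joined k (proj k (3 * int k, s)) (proj k (3 * int k, \<not> s))"
proof -
  let ?xs = "down s 1 (3 * int k) @ up (\<not> s) 1 (3 * int k)"
  have "1 \<le> 3 * int k" using k by simp
  note rows = row_simps[OF this]
  have "strip_adj (1, s) (1, \<not> s)" by (simp add: strip_adj.simps)
  then have "successively strip_adj ?xs"
    unfolding successively_append_iff using rows successively_up successively_down by simp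
  then show ?thesis
  proof (rule joinedI[where a = 1 and b = 1 and s = s])
    show "length ?xs = 6 * k" by simp
    show "hd ?xs = (3 * int k, s)" "last ?xs = (3 * int k, \<not> s)" using rows by simp_all
  next
    fix c assume "1 \<le> c" "c < 1 + 3 * int k"
    then show "(c, s) \<in> set ?xs" "(c, \<not> s) \<in> set ?xs"
      unfolding set_append set_rev Un_iff mem_up by auto
  qed
qed

text \<open>One lap down row \<open>s\<close>, then over the rung in column \<open>3 * k + 1\<close>
  and one lap down row \<open>\<not> s\<close>.\<close>

lemma joined_02_same_block: "joined k (proj k (2, \<not> s)) (proj k (6 * int k, s))"
proof -
  let ?xs = "down s (3 * int k + 1) (6 * int k) @ down (\<not> s) 2 (3 * int k + 1)"
  have "3 * int k + 1 \<le> 6 * int k" "2 \<le> 3 * int k + 1" using k by simp_all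
  note rows = this[THEN row_simps(3)] this[THEN row_simps(4)] this[THEN row_simps(5)]
  have "strip_adj (3 * int k + 1, s) (3 * int k + 1, \<not> s)" by (simp add: strip_adj.simps)
  then have "successively strip_adj ?xs"
    unfolding successively_append_iff using rows successively_down by simp
  then show ?thesis
  proof (rule joined_sym[OF joinedI[where a = "3 * int k + 1" and b = 2 and s = s]])
    show "length ?xs = 6 * k" by simp
    show "hd ?xs = (6 * int k, s)" "last ?xs = (2, \<not> s)" using rows by simp_all
  next
    fix c assume "3 * int k + 1 \<le> c" "c < 3 * int k + 1 + 3 * int k"
    then show "(c, s) \<in> set ?xs"
      unfolding set_append set_rev Un_iff mem_up by auto
  next
    fix c assume "2 \<le> c" "c < 2 + 3 * int k"
    then show "(c, \<not> s) \<in> set ?xs"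
      unfolding set_append set_rev Un_iff mem_up by auto
  qed
qed

section \<open>Reduction of arbitrary end points to the explicit paths\<close>

text \<open>Translation moves the second end point to block 0; only the offset of the blocks modulo
  \<open>k\<close> remains.\<close>

lemma joined_anchor:
  assumes "joined k (proj k (3 * ((i - l) mod int k) + a, s)) (proj k (b, t))"
  shows "joined k (proj k (3 * i + a, s)) (proj k (3 * l + b, t))"
proof -
  have "joined k (proj k (3 * ((i - l) mod int k) + a + 3 * l, s)) (proj k (b + 3 * l, t))"
    by (rule joined_shift[OF assms])
  moreover have "(3 * ((i - l) mod int k) + a + 3 * l) mod (3 * int k) = (3 * i + a) mod (3 * int k)"
  proof -
    have "3 * ((i - l) mod int k) = 3 * (i - l) - 3 * int k * ((i - l) div int k)"
      by (simp add: minus_mult_div_eq_mod[symmetric] algebra_simps)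
    then have "3 * i + a = (3 * ((i - l) mod int k) + a + 3 * l) + 3 * int k * ((i - l) div int k)"
      by (simp add: algebra_simps)
    then show ?thesis by (simp only: mod_mult_self2)
  qed
  then have "proj k (3 * ((i - l) mod int k) + a + 3 * l, s) = proj k (3 * i + a, s)"
    by (simp add: proj_eq_iff)
  ultimately show ?thesis by (simp add: add.commute)
qed

lemma block_offset:
  assumes "i mod int k \<noteq> l mod int k"
  shows "1 \<le> (i - l) mod int k" "(i - l) mod int k < int k"
proof -
  have "(i - l) mod int k \<noteq> 0" using assms by (simp add: mod_eq_dvd_iff mod_eq_0_iff_dvd)
  moreover have "0 \<le> (i - l) mod int k" "(i - l) mod int k < int k" using k by simp_all
  ultimately show "1 \<le> (i - l) mod int k" "(i - l) mod int k < int k" by simp_all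
qed

lemma block_offset_eq: "i mod int k = l mod int k \<Longrightarrow> (i - l) mod int k = 0"
  by (simp add: mod_eq_dvd_iff)

lemma proj_3k: "proj k (3 * int k, s) = proj k (0, s)"
  by (simp add: proj_eq_iff)

lemma joined_twist_blocks:
  assumes "joined k (proj k (3 * i + a, s)) (proj k (3 * l + b, t))"
    and "i mod int k \<noteq> l mod int k" "a \<in> {0..2}" "b \<in> {0..2}"
  shows "joined k (proj k (3 * i + a, s')) (proj k (3 * l + b, t'))"
proof (rule joined_twist[OF assms(1)])
  have "(3 * i + a) div 3 = i" "(3 * l + b) div 3 = l" using assms(3,4) by auto
  with assms(2) show "(3 * i + a) div 3 mod int k \<noteq> (3 * l + b) div 3 mod int k" by simp
qed

lemma joined_blocks_00:
  assumes "i mod int k \<noteq> l mod int k \<or> s \<noteq> t"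
  shows "joined k (proj k (3 * i + 0, s)) (proj k (3 * l + 0, t))"
proof (cases "i mod int k = l mod int k")
  case True
  then have "t = (\<not> s)" using assms by auto
  then show ?thesis
    using joined_00_same_block[of s] joined_anchor[of i l 0 s 0 t]
    by (simp add: proj_3k block_offset_eq[OF True])
next
  case False
  \<comment> \<open>In different blocks one choice of rows suffices; twisting yields the
    others.\<close>
  have "joined k (proj k (3 * ((i - l) mod int k) + 0, False)) (proj k (0, True))"
    using joined_00[OF block_offset[OF False], of True] by (simp add: proj_3k)
  from joined_twist_blocks[OF joined_anchor[OF this] False] show ?thesis by simp
qed

lemma joined_blocks_10: "joined k (proj k (3 * i + 1, s)) (proj k (3 * l + 0, t))"
proof (cases "i mod int k = l mod int k")
  case True
  have "joined k (proj k (1, s)) (proj k (0, t))"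
  proof (cases "s = t")
    case True
    then show ?thesis using joined_10[of 0 s] k by (simp add: proj_3k)
  next
    case False
    then have "t = (\<not> s)" by auto
    then show ?thesis using joined_10_same_block[of s] by (simp add: proj_3k)
  qed
  then show ?thesis using joined_anchor[of i l 1 s 0 t] by (simp add: block_offset_eq[OF True])
next
  case False
  have "joined k (proj k (3 * ((i - l) mod int k) + 1, True)) (proj k (0, True))"
    using joined_10[of "(i - l) mod int k" True] k by (simp add: proj_3k)
  from joined_twist_blocks[OF joined_anchor[OF this] False] show ?thesis by simp
qed

lemma joined_blocks_11:
  assumes "i mod int k \<noteq> l mod int k \<or> s \<noteq> t"
  shows "joined k (proj k (3 * i + 1, s)) (proj k (3 * l + 1, t))"
proof -
  have *: "joined k (proj k (3 * ((i - l) mod int k) + 1, s)) (proj k (1, \<not> s))" for s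
  proof -
    have "proj k (3 * int k + 3 * ((i - l) mod int k) + 1, s) = proj k (3 * ((i - l) mod int k) + 1, s)"
      by (simp add: proj_eq_iff add.assoc)
    then show ?thesis using joined_11[of "(i - l) mod int k" s] k by simp
  qed
  show ?thesis
  proof (cases "i mod int k = l mod int k")
    case True
    then have "t = (\<not> s)" using assms by auto
    then show ?thesis using joined_anchor[OF *] by simp
  next
    case False
    from joined_twist_blocks[OF joined_anchor[OF *] False] show ?thesis by simp
  qed
qed

lemma joined_blocks_20: "joined k (proj k (3 * i + 2, s)) (proj k (3 * l + 0, t))"
proof -
  have *: "joined k (proj k (3 * ((i - l) mod int k) + 2, s)) (proj k (0, s))" for s
    using joined_02[of "(i - l) mod int k" s] k by simp
  show ?thesis
  proof (cases "i mod int k = l mod int k")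
    case True
    show ?thesis
    proof (cases "s = t")
      case True
      then show ?thesis using joined_anchor[OF *] by simp
    next
      case False
      then have "s = (\<not> t)" by auto
      moreover have "proj k (6 * int k, t) = proj k (0, t)"
        by (simp add: proj_eq_iff)
      ultimately have "joined k (proj k (2, s)) (proj k (0, t))"
        using joined_02_same_block[of t] by simp
      then show ?thesis using joined_anchor[of i l 2 s 0 t] by (simp add: block_offset_eq[OF True])
    qed
  next
    case False
    from joined_twist_blocks[OF joined_anchor[OF *] False] show ?thesis by simp
  qed
qed

text \<open>The reflection \<open>2 - c\<close> turns residue 0 in block \<open>- i\<close> into
  residue 2 in block \<open>i\<close>.\<close>

lemma joined_blocks_22:
  assumes "i mod int k \<noteq> l mod int k \<or> s \<noteq> t"
  shows "joined k (proj k (3 * i + 2, s)) (proj k (3 * l + 2, t))"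
proof -
  have "(- i) mod int k \<noteq> (- l) mod int k \<or> s \<noteq> t"
    using assms by (simp add: mod_eq_dvd_iff dvd_diff_commute)
  from joined_reflect[OF joined_blocks_00[OF this]] show ?thesis by (simp add: add.commute)
qed

lemma joined_blocks_12: "joined k (proj k (3 * i + 1, s)) (proj k (3 * l + 2, t))"
  using joined_reflect[OF joined_blocks_10[of "- i" s "- l" t]] by (simp add: add.commute)

lemma joined_proj:
  assumes "proj k p \<noteq> proj k q"
  shows "joined k (proj k p) (proj k q)"
proof -
  obtain i a s where p: "p = (3 * i + a, s)" "a \<in> {0, 1, 2}"
  proof
    show "p = (3 * (fst p div 3) + fst p mod 3, snd p)" by simp
    show "fst p mod 3 \<in> {0, 1, 2}" by simp presburger
  qed
  obtain l b t where q: "q = (3 * l + b, t)" "b \<in> {0, 1, 2}"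
  proof
    show "q = (3 * (fst q div 3) + fst q mod 3, snd q)" by simp
    show "fst q mod 3 \<in> {0, 1, 2}" by simp presburger
  qed
  \<comment> \<open>Equal residues need different blocks or rows; this is where distinctness of the
    end points enters.\<close>
  have distinct: "i mod int k \<noteq> l mod int k \<or> s \<noteq> t" if "a = b"
  proof (rule ccontr)
    assume "\<not> ?thesis"
    then have "int k dvd i - l" "s = t" by (simp_all add: mod_eq_dvd_iff)
    then have "3 * int k dvd 3 * (i - l)" by (intro mult_dvd_mono) simp_all
    then have "(3 * i + a) mod (3 * int k) = (3 * l + b) mod (3 * int k)"
      using that by (simp add: mod_eq_dvd_iff algebra_simps)
    with assms \<open>s = t\<close> show False unfolding p q by (simp add: proj_eq_iff)
  qed
  have "a = 0 \<or> a = 1 \<or> a = 2" "b = 0 \<or> b = 1 \<or> b = 2" using p(2) q(2) by simp_all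
  \<comment> \<open>Of the nine residue pairs, six are direct and three follow by reversing the
    path.\<close>
  then have "joined k (proj k (3 * i + a, s)) (proj k (3 * l + b, t))"
    by (elim disjE)
      (simp_all only: distinct joined_blocks_00 joined_blocks_11 joined_blocks_22 joined_blocks_10
        joined_blocks_12 joined_blocks_20 joined_blocks_10[THEN joined_sym]
        joined_blocks_12[THEN joined_sym] joined_blocks_20[THEN joined_sym])
  then show ?thesis unfolding p q .
qed

lemma hamiltonian_connected_ring: "hamiltonian_connected (with_proj (ring_graph k))"
  unfolding hamiltonian_connected_def
proof (intro ballI impI)
  fix u v assume uv: "u \<in> verts (with_proj (ring_graph k))" "v \<in> verts (with_proj (ring_graph k))" "u \<noteq> v"
  then obtain p q where "u = proj k p" "v = proj k q"
    using proj_surj[of u] proj_surj[of v] unfolding ring_graph_def by (auto simp del: split_paired_Ex)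
  then have "joined k u v" using joined_proj uv(3) by blast
  then obtain xs where xs: "length xs = 6 * k" "distinct (map (proj k) xs)" "successively strip_adj xs"
    "proj k (hd xs) = u" "proj k (last xs) = v"
    unfolding joined_def by blast
  then obtain x xs' where x: "xs = x # xs'" using k by (cases xs) auto
  let ?vs = "map (proj k) xs'"
  have vs: "map (proj k) xs = u # ?vs" using xs(4) x by simp
  have last: "last (u # ?vs) = v" using xs(5) x last_map[of xs "proj k"] unfolding vs[symmetric] by simp
  have "successively (\<lambda>u v. (u, v) \<in> parcs (ring_graph k)) (u # ?vs)"
    using successively_proj[OF xs(3)] unfolding vs .
  note walk = awalk_zip[OF this, unfolded last]
  have u: "u \<in> pverts (ring_graph k)" using uv(1) by simp
  have "set (u # ?vs) \<subseteq> {..<6 * k}"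
    unfolding vs[symmetric] using proj_less by auto
  moreover have "card (set (u # ?vs)) = card {..<6 * k}"
    unfolding vs[symmetric] using xs(1) distinct_card[OF xs(2)] by simp
  ultimately have "set (u # ?vs) = {..<6 * k}" by (rule card_subset_eq[OF finite_lessThan])
  then have "set (u # ?vs) = verts (with_proj (ring_graph k))" by (simp add: ring_graph_def)
  moreover have "pre_digraph.apath (with_proj (ring_graph k)) u (zip (u # ?vs) ?vs) v"
    unfolding pre_digraph.apath_def walk(2)[OF u] using walk(1)[OF u] xs(2) unfolding vs by blast
  ultimately show "\<exists>p. pre_digraph.apath (with_proj (ring_graph k)) u p v
      \<and> set (pre_digraph.awalk_verts (with_proj (ring_graph k)) u p) = verts (with_proj (ring_graph k))"
    using walk(2)[OF u] by (intro exI[of _ "zip (u # ?vs) ?vs"]) simp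
qed

end

theorem theorem2:
  fixes k :: nat
  assumes "k \<ge> 2"
  shows "\<exists>G :: nat pair_pre_digraph.
           pair_graph G \<and>
           card (pverts G) = 6 * k \<and>
           cubic (with_proj G) \<and>
           hamiltonian_connected (with_proj G) \<and>
           cycle_spectrum (with_proj G) =
             {4} \<union> {3 * m + 2 | m. m \<in> {1..k - 1}} \<union> {3 * k..6 * k}"
proof (intro exI[of _ "ring_graph k"] conjI)
  show "card (pverts (ring_graph k)) = 6 * k" by (simp add: ring_graph_def)
qed (rule pair_graph_ring[OF assms] cubic_ring[OF assms] hamiltonian_connected_ring[OF assms]
  cycle_spectrum_ring[OF assms])+

end
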